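(* Let $t\in\mathbb{C}$ with $|t|<1$ be fixed, and for each non-negative integer $k$ let $\lambda_k^{\max}$ be the maximum eigenvalue of the perturbed Kohn Laplacian $\square_b^t$ on the finite-dimensional space $\mathcal{H}_k(\mathbb{S}^3)$. Then $\lambda_k^{\max}=\Theta(k^2)$ as $k\to\infty$; that is, there exists a real constant $c>0$ such that $$\frac1c\,k^2\le\lambda_k^{\max}\le c\,k^2$$ for all sufficiently large $k$.
   Context: $\mathbb{S}^3$ is the unit sphere in $\mathbb{C}^2$. $\mathcal{H}_k(\mathbb{S}^3)$ is the space of restrictions to $\mathbb{S}^3$ of the complex polynomials in $z_1,z_2,\overline z_1,\overline z_2$ that are homogeneous of total degree $k$ and harmonic, i.e. annihilated by $4\sum_{i=1}^2\frac{\partial^2}{\partial z_i\partial\overline z_i}$. Define the operators $$\mathcal{L}=\overline z_1\frac{\partial}{\partial z_2}-\overline z_2\frac{\partial}{\partial z_1},\qquad \overline{\mathcal{L}}=z_1\frac{\partial}{\partial\overline z_2}-z_2\frac{\partial}{\partial\overline z_1},$$ which are tangent to $\mathbb{S}^3$, and set $\mathcal{L}_t=\mathcal{L}+\overline t\,\overline{\mathcal{L}}$ and $\overline{\mathcal{L}}_t=\overline{\mathcal{L}}+t\,\mathcal{L}$. The perturbed Kohn Laplacian (of the Rossi sphere) is $$\square_b^t=-\mathcal{L}_t\,\frac{1+|t|^2}{(1-|t|^2)^2}\,\overline{\mathcal{L}}_t ,$$ which maps $\mathcal{H}_k(\mathbb{S}^3)$ to itself. *)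

theory Defs
  imports "HOL-Analysis.Analysis"
begin

definition S3 :: "(complex \<times> complex) set" where
  "S3 = sphere 0 1"

text \<open>Wirtinger derivatives: \<open>\<partial>/\<partial>z = (\<partial>/\<partial>x - \<i> \<partial>/\<partial>y) / 2\<close> and
  \<open>\<partial>/\<partial>zbar = (\<partial>/\<partial>x + \<i> \<partial>/\<partial>y) / 2\<close>. Here \<^const>\<open>frechet_derivative\<close> is the
  real-linear differential, so \<open>(1, 0), (\<i>, 0), (0, 1), (0, \<i>)\<close> are the four real coordinate
  directions.\<close>

definition dz1 :: "(complex \<times> complex \<Rightarrow> complex) \<Rightarrow> complex \<times> complex \<Rightarrow> complex" where
  "dz1 f p = (frechet_derivative f (at p) (1, 0) - \<i> * frechet_derivative f (at p) (\<i>, 0)) / 2"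

definition dz2 :: "(complex \<times> complex \<Rightarrow> complex) \<Rightarrow> complex \<times> complex \<Rightarrow> complex" where
  "dz2 f p = (frechet_derivative f (at p) (0, 1) - \<i> * frechet_derivative f (at p) (0, \<i>)) / 2"

definition dzbar1 :: "(complex \<times> complex \<Rightarrow> complex) \<Rightarrow> complex \<times> complex \<Rightarrow> complex" where
  "dzbar1 f p = (frechet_derivative f (at p) (1, 0) + \<i> * frechet_derivative f (at p) (\<i>, 0)) / 2"

definition dzbar2 :: "(complex \<times> complex \<Rightarrow> complex) \<Rightarrow> complex \<times> complex \<Rightarrow> complex" where
  "dzbar2 f p = (frechet_derivative f (at p) (0, 1) + \<i> * frechet_derivative f (at p) (0, \<i>)) / 2"

definition complex_laplacian :: "(complex \<times> complex \<Rightarrow> complex) \<Rightarrow> complex \<times> complex \<Rightarrow> complex" where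
  "complex_laplacian f p = 4 * (dz1 (dzbar1 f) p + dz2 (dzbar2 f) p)"

definition homogeneous_polys :: "nat \<Rightarrow> (complex \<times> complex \<Rightarrow> complex) set" where
  "homogeneous_polys k =
    {f. \<exists>c :: nat \<Rightarrow> nat \<Rightarrow> nat \<Rightarrow> nat \<Rightarrow> complex. \<forall>z1 z2.
          f (z1, z2) = (\<Sum>(a, b, a', b') \<in> {(a, b, a', b'). a + b + a' + b' = k}.
                          c a b a' b' * z1 ^ a * z2 ^ b * cnj z1 ^ a' * cnj z2 ^ b')}"

definition harmonic_polys :: "nat \<Rightarrow> (complex \<times> complex \<Rightarrow> complex) set" where
  "harmonic_polys k = {f \<in> homogeneous_polys k. \<forall>p. complex_laplacian f p = 0}"

text \<open>Functions on the sphere are represented extensionally (\<^const>\<open>undefined\<close> off the sphere).\<close>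

definition spherical_harmonics :: "nat \<Rightarrow> (complex \<times> complex \<Rightarrow> complex) set" where
  "spherical_harmonics k = (\<lambda>f. restrict f S3) ` harmonic_polys k"

definition L_op :: "(complex \<times> complex \<Rightarrow> complex) \<Rightarrow> complex \<times> complex \<Rightarrow> complex" where
  "L_op f = (\<lambda>(z1, z2). cnj z1 * dz2 f (z1, z2) - cnj z2 * dz1 f (z1, z2))"

definition Lbar_op :: "(complex \<times> complex \<Rightarrow> complex) \<Rightarrow> complex \<times> complex \<Rightarrow> complex" where
  "Lbar_op f = (\<lambda>(z1, z2). z1 * dzbar2 f (z1, z2) - z2 * dzbar1 f (z1, z2))"

definition Lt_op :: "complex \<Rightarrow> (complex \<times> complex \<Rightarrow> complex) \<Rightarrow> complex \<times> complex \<Rightarrow> complex" where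
  "Lt_op t f p = L_op f p + cnj t * Lbar_op f p"

definition Lbart_op :: "complex \<Rightarrow> (complex \<times> complex \<Rightarrow> complex) \<Rightarrow> complex \<times> complex \<Rightarrow> complex" where
  "Lbart_op t f p = Lbar_op f p + t * L_op f p"

definition box_op :: "complex \<Rightarrow> (complex \<times> complex \<Rightarrow> complex) \<Rightarrow> complex \<times> complex \<Rightarrow> complex" where
  "box_op t f p =
    - Lt_op t (\<lambda>q. complex_of_real ((1 + (cmod t)\<^sup>2) / (1 - (cmod t)\<^sup>2)\<^sup>2) * Lbart_op t f q) p"

text \<open>A differential operator built from tangent vector fields acts on a function on the sphere by
  acting on any smooth extension to a neighbourhood and restricting the result; the extension used
  here is the one that is constant on rays. The lemma \<open>box_S3_restrict\<close> below shows that on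
  restrictions of homogeneous polynomials one may equally use the polynomial itself.\<close>

definition box_S3 :: "complex \<Rightarrow> (complex \<times> complex \<Rightarrow> complex) \<Rightarrow> complex \<times> complex \<Rightarrow> complex" where
  "box_S3 t g = restrict (box_op t (\<lambda>p. g (p /\<^sub>R norm p))) S3"

text \<open>An auxiliary smoothness predicate, used only in the proof of \<open>box_S3_restrict\<close>.\<close>

definition C2 :: "(complex \<times> complex \<Rightarrow> complex) \<Rightarrow> bool" where
  "C2 f \<longleftrightarrow> (\<exists>D. (\<forall>p. (f has_derivative D p) (at p)) \<and> (\<forall>v p. (\<lambda>q. D q v) differentiable (at p)))"

lemma C2_mult:
  assumes "C2 f" "C2 g"
  shows "C2 (\<lambda>p. f p * g p)"
proof -
  obtain D where D: "\<And>p. (f has_derivative D p) (at p)" "\<And>v p. (\<lambda>q. D q v) differentiable (at p)"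
    using assms(1) unfolding C2_def by blast
  obtain E where E: "\<And>p. (g has_derivative E p) (at p)" "\<And>v p. (\<lambda>q. E q v) differentiable (at p)"
    using assms(2) unfolding C2_def by blast
  have fg: "f differentiable (at p)" "g differentiable (at p)" for p
    using D(1) E(1) unfolding differentiable_def by blast+
  show ?thesis
    unfolding C2_def
  proof (intro exI[of _ "\<lambda>p v. f p * E p v + D p v * g p"] conjI allI)
    show "((\<lambda>p. f p * g p) has_derivative (\<lambda>v. f p * E p v + D p v * g p)) (at p)" for p
      by (rule has_derivative_mult[OF D(1) E(1)])
    show "(\<lambda>q. f q * E q v + D q v * g q) differentiable (at p)" for v p
      by (intro differentiable_add differentiable_mult D(2) E(2) fg)
  qed
qed

lemma C2_const: "C2 (\<lambda>p. c)"
  unfolding C2_def by (intro exI[of _ "\<lambda>p v. 0"]) auto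

lemma C2_add:
  assumes "C2 f" "C2 g"
  shows "C2 (\<lambda>p. f p + g p)"
proof -
  obtain D where D: "\<And>p. (f has_derivative D p) (at p)" "\<And>v p. (\<lambda>q. D q v) differentiable (at p)"
    using assms(1) unfolding C2_def by blast
  obtain E where E: "\<And>p. (g has_derivative E p) (at p)" "\<And>v p. (\<lambda>q. E q v) differentiable (at p)"
    using assms(2) unfolding C2_def by blast
  show ?thesis
    unfolding C2_def
    by (intro exI[of _ "\<lambda>p v. D p v + E p v"] conjI allI has_derivative_add differentiable_add D E)
qed

lemma C2_sum: "(\<And>i. i \<in> I \<Longrightarrow> C2 (f i)) \<Longrightarrow> C2 (\<lambda>p. \<Sum>i\<in>I. f i p)"
  by (induction I rule: infinite_finite_induct) (auto intro: C2_const C2_add)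

lemma C2_power: "C2 f \<Longrightarrow> C2 (\<lambda>p. f p ^ n)"
  by (induction n) (auto intro: C2_const C2_mult)

lemma C2_linear: "bounded_linear f \<Longrightarrow> C2 f"
  unfolding C2_def by (intro exI[of _ "\<lambda>p. f"]) (auto intro: bounded_linear_imp_has_derivative)

lemma C2_homogeneous_polys:
  assumes "f \<in> homogeneous_polys k"
  shows "C2 f"
proof -
  obtain c where c: "\<And>z1 z2. f (z1, z2) = (\<Sum>(a, b, a', b') \<in> {(a, b, a', b'). a + b + a' + b' = k}.
                          c a b a' b' * z1 ^ a * z2 ^ b * cnj z1 ^ a' * cnj z2 ^ b')"
    using assms unfolding homogeneous_polys_def by blast
  have f: "f = (\<lambda>p. \<Sum>i \<in> {(a, b, a', b'). a + b + a' + b' = k}.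
     (case i of (a, b, a', b') \<Rightarrow> c a b a' b' * fst p ^ a * snd p ^ b * cnj (fst p) ^ a' * cnj (snd p) ^ b'))"
    using c by (auto simp: fun_eq_iff)
  have lin: "bounded_linear (\<lambda>p::complex \<times> complex. cnj (fst p))"
            "bounded_linear (\<lambda>p::complex \<times> complex. cnj (snd p))"
    by (rule bounded_linear_compose[OF bounded_linear_cnj bounded_linear_fst]
             bounded_linear_compose[OF bounded_linear_cnj bounded_linear_snd])+
  show ?thesis
    unfolding f
    by (intro C2_sum, clarify)
      (intro C2_mult C2_power C2_const C2_linear bounded_linear_fst bounded_linear_snd lin)
qed

lemma homogeneous_polys_scaleR:
  assumes "f \<in> homogeneous_polys k"
  shows "f (r *\<^sub>R p) = complex_of_real r ^ k * f p"
proof -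
  obtain c where c: "\<And>z1 z2. f (z1, z2) = (\<Sum>(a, b, a', b') \<in> {(a, b, a', b'). a + b + a' + b' = k}.
                          c a b a' b' * z1 ^ a * z2 ^ b * cnj z1 ^ a' * cnj z2 ^ b')"
    using assms unfolding homogeneous_polys_def by blast
  obtain z w where p: "p = (z, w)" by fastforce
  show ?thesis
    unfolding p scaleR_Pair c sum_distrib_left
    by (rule sum.cong)
      (auto simp: scaleR_conv_of_real power_mult_distrib power_add)
qed

lemma L_ops_radial_mult:
  fixes f :: "complex \<times> complex \<Rightarrow> complex"
  assumes f: "f differentiable (at p)" and p: "p \<noteq> 0"
    and g: "\<And>q. q \<noteq> 0 \<Longrightarrow> g q = complex_of_real (inverse (norm q) ^ k) * f q"
  shows "L_op g p = complex_of_real (inverse (norm p) ^ k) * L_op f p"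
    and "Lbar_op g p = complex_of_real (inverse (norm p) ^ k) * Lbar_op f p"
proof -
  obtain s where s: "((\<lambda>q. inverse (norm q) ^ k) has_derivative (\<lambda>v. s * (p \<bullet> v))) (at p)"
  proof
    show "((\<lambda>q. inverse (norm q) ^ k) has_derivative
        (\<lambda>v. (- real k * inverse (norm p) ^ (k - 1) * inverse (norm p) * inverse (norm p) / norm p) * (p \<bullet> v))) (at p)"
      by (rule has_derivative_eq_rhs[OF has_derivative_power[OF Deriv.has_derivative_inverse[OF _ has_derivative_norm[OF p]]]])
        (use p in \<open>auto simp: sgn_div_norm fun_eq_iff divide_inverse inner_commute algebra_simps\<close>)
  qed
  define h where "h = (\<lambda>q::complex \<times> complex. complex_of_real (inverse (norm q) ^ k))"
  define F where "F = frechet_derivative f (at p)"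
  have dh: "(h has_derivative (\<lambda>v. complex_of_real (s * (p \<bullet> v)))) (at p)"
    unfolding h_def by (rule has_derivative_of_real[OF s])
  have dF: "(f has_derivative F) (at p)"
    using f unfolding F_def by (simp add: frechet_derivative_works)
  have "((\<lambda>q. h q * f q) has_derivative (\<lambda>v. h p * F v + complex_of_real (s * (p \<bullet> v)) * f p)) (at p)"
    by (rule has_derivative_mult[OF dh dF])
  then have "(g has_derivative (\<lambda>v. h p * F v + complex_of_real (s * (p \<bullet> v)) * f p)) (at p)"
    by (rule has_derivative_transform_within_open[of _ _ p UNIV "- {0}"]) (use p g in \<open>auto simp: h_def\<close>)
  then have G: "frechet_derivative g (at p) = (\<lambda>v. h p * F v + complex_of_real (s * (p \<bullet> v)) * f p)"
    using frechet_derivative_at by metis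
  obtain z w where pz: "p = (z, w)" by fastforce
  have inn: "p \<bullet> (1, 0) = Re z" "p \<bullet> (\<i>, 0) = Im z" "p \<bullet> (0, 1) = Re w" "p \<bullet> (0, \<i>) = Im w"
    by (simp_all add: pz inner_complex_def)
  have z: "z = complex_of_real (Re z) + \<i> * complex_of_real (Im z)"
          "cnj z = complex_of_real (Re z) - \<i> * complex_of_real (Im z)"
          "w = complex_of_real (Re w) + \<i> * complex_of_real (Im w)"
          "cnj w = complex_of_real (Re w) - \<i> * complex_of_real (Im w)"
    by (simp_all add: complex_eq_iff)
  have dz: "dz1 g p = h p * dz1 f p + of_real s * cnj z * f p / 2"
           "dz2 g p = h p * dz2 f p + of_real s * cnj w * f p / 2"
    unfolding dz1_def dz2_def G inn F_def[symmetric] z(2,4) by (simp_all add: field_simps)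
  have dzb: "dzbar1 g p = h p * dzbar1 f p + of_real s * z * f p / 2"
           "dzbar2 g p = h p * dzbar2 f p + of_real s * w * f p / 2"
    unfolding dzbar1_def dzbar2_def G inn F_def[symmetric]
    by (subst (3) z, simp add: field_simps)+
  show "L_op g p = complex_of_real (inverse (norm p) ^ k) * L_op f p"
    unfolding L_op_def pz case_prod_conv dz[unfolded pz h_def] by (simp add: algebra_simps)
  show "Lbar_op g p = complex_of_real (inverse (norm p) ^ k) * Lbar_op f p"
    unfolding Lbar_op_def pz case_prod_conv dzb[unfolded pz h_def] by (simp add: algebra_simps)
qed

lemma C2_Lbart_differentiable:
  assumes "C2 f"
  shows "(\<lambda>q. Lbart_op t f q) differentiable (at p)"
proof -
  obtain D where D: "\<And>p. (f has_derivative D p) (at p)" "\<And>v p. (\<lambda>q. D q v) differentiable (at p)"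
    using assms unfolding C2_def by blast
  have fr: "frechet_derivative f (at p) = D p" for p
    using frechet_derivative_at[OF D(1)] by simp
  have lin: "(\<lambda>p::complex \<times> complex. cnj (fst p)) differentiable (at p)"
            "(\<lambda>p::complex \<times> complex. cnj (snd p)) differentiable (at p)"
            "(fst :: complex \<times> complex \<Rightarrow> _) differentiable (at p)"
            "(snd :: complex \<times> complex \<Rightarrow> _) differentiable (at p)"
    by (intro bounded_linear_imp_differentiable bounded_linear_fst bounded_linear_snd
             bounded_linear_compose[OF bounded_linear_cnj])+
  show ?thesis
    unfolding Lbart_op_def Lbar_op_def L_op_def case_prod_beta prod.collapse
      dz1_def dz2_def dzbar1_def dzbar2_def fr divide_inverse
    by (intro differentiable_add differentiable_diff differentiable_mult differentiable_const D(2) lin)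
qed

lemma box_S3_restrict:
  assumes f: "f \<in> homogeneous_polys k"
  shows "box_S3 t (restrict f S3) = restrict (box_op t f) S3"
proof -
  define g where "g = (\<lambda>p. restrict f S3 (p /\<^sub>R norm p))"
  define C where "C = complex_of_real ((1 + (cmod t)\<^sup>2) / (1 - (cmod t)\<^sup>2)\<^sup>2)"
  have g: "g q = complex_of_real (inverse (norm q) ^ k) * f q" if "q \<noteq> 0" for q
    using that homogeneous_polys_scaleR[OF f, of "inverse (norm q)" q]
    by (simp add: g_def S3_def)
  have C2: "C2 f" by (rule C2_homogeneous_polys[OF f])
  then have df: "f differentiable (at p)" for p
    unfolding C2_def differentiable_def by blast
  have 1: "C * Lbart_op t g q = complex_of_real (inverse (norm q) ^ k) * (C * Lbart_op t f q)"
    if "q \<noteq> 0" for q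
    using L_ops_radial_mult[OF df that, of g k] g
    unfolding Lbart_op_def by (simp add: algebra_simps)
  have d: "(\<lambda>q. C * Lbart_op t f q) differentiable (at p)" for p
    by (intro differentiable_mult differentiable_const C2_Lbart_differentiable C2)
  have "box_op t g p = box_op t f p" if "p \<in> S3" for p
  proof -
    from that have "p \<noteq> 0" "norm p = 1" by (auto simp: S3_def)
    with L_ops_radial_mult[OF d \<open>p \<noteq> 0\<close> 1] show ?thesis
      unfolding box_op_def C_def[symmetric] Lt_op_def by simp
  qed
  then show ?thesis
    unfolding box_S3_def g_def[symmetric] by (auto simp: restrict_def)
qed

definition box_eigenvalues :: "complex \<Rightarrow> nat \<Rightarrow> complex set" where
  "box_eigenvalues t k =
    {\<mu>. \<exists>g \<in> spherical_harmonics k. g \<noteq> restrict (\<lambda>_. 0) S3 \<and> box_S3 t g = restrict (\<lambda>p. \<mu> * g p) S3}"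

text \<open>The operator is symmetric for the \<open>L\<^sup>2\<close> inner product of the sphere, so that its
  eigenvalues are real; \<^const>\<open>Re\<close> only converts them to type \<^typ>\<open>real\<close>.\<close>

definition lambda_max :: "complex \<Rightarrow> nat \<Rightarrow> real" where
  "lambda_max t k = Max (Re ` box_eigenvalues t k)"

end

theory Submission
  imports Defs "HOL-Library.Function_Algebras" "Jordan_Normal_Form.Schur_Decomposition"
begin

text \<open>The space of polynomials in \<open>cnj z1\<close> and \<open>z2\<close> homogeneous of degree \<open>k\<close> consists of harmonic
  polynomials and is invariant under the operator. In the monomial basis the diagonal entries are
  \<open>C ((k - j) (j + 1) + |t|\<^sup>2 j (k - j + 1))\<close>, so their average grows like \<open>k\<^sup>2\<close>, and some eigenvalue
  has a real part at least as large as this average. For the upper bound, each of \<open>L\<close> and \<open>Lbar\<close>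
  multiplies the sum of the absolute values of the coefficients of a polynomial by at most \<open>k\<close>;
  comparing the growth of the iterates of the operator on an eigenfunction bounds the eigenvalue by
  \<open>C (1 + |t|)\<^sup>2 k\<^sup>2\<close>. Here \<open>C = (1 + |t|\<^sup>2) / (1 - |t|\<^sup>2)\<^sup>2\<close>.\<close>

section \<open>Linear algebra\<close>

text \<open>The trace is a similarity invariant and the Schur form carries the eigenvalues on its
  diagonal. So the real parts of the eigenvalues have the same average as those of the diagonal
  entries, and some eigenvalue reaches it.\<close>

lemma eigenvalue_Re_ge_average_diagonal:
  fixes a :: "nat \<Rightarrow> nat \<Rightarrow> complex"
  assumes "n > 0"
  obtains \<mu> w where "\<exists>i<n. w i \<noteq> 0" "\<And>i. i < n \<Longrightarrow> (\<Sum>j<n. a i j * w j) = \<mu> * w i"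
    "(\<Sum>i<n. Re (a i i)) \<le> real n * Re \<mu>"
proof -
  define A where "A = Matrix.mat n n (\<lambda>(i, j). a i j)"
  have A: "A \<in> carrier_mat n n" by (simp add: A_def)
  obtain es where es: "char_poly A = (\<Prod>e\<leftarrow>es. [:- e, 1:])" "length es = n"
    using char_poly_factorized[OF A] by blast
  obtain B P Q where "schur_decomposition A es = (B, P, Q)"
    by (cases "schur_decomposition A es")
  then have sim: "similar_mat_wit A B P Q" and diag: "diag_mat B = es"
    using schur_decomposition[OF A es(1)] by auto
  note mats = similar_mat_witD2[OF A sim]
  \<comment> \<open>Cyclicity of the trace; it brings \<open>Q\<close> next to \<open>P\<close>,
    where they cancel.\<close>
  have comm: "(\<Sum>i<n. (M * N) $$ (i, i)) = (\<Sum>i<n. (N * M) $$ (i, i))"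
    if "M \<in> carrier_mat n n" "N \<in> carrier_mat n n" for M N :: "complex mat"
    using that by (simp add: scalar_prod_def)
      (subst sum.swap, simp add: atLeast0LessThan mult.commute)
  have "(\<Sum>i<n. A $$ (i, i)) = (\<Sum>i<n. (P * (B * Q)) $$ (i, i))"
    using assoc_mult_mat[OF mats(6,5,7)] mats(3) by simp
  also have "\<dots> = (\<Sum>i<n. (B * (Q * P)) $$ (i, i))"
    using comm[OF mats(6) mult_carrier_mat[OF mats(5,7)]] assoc_mult_mat[OF mats(5,7,6)] by simp
  also have "\<dots> = (\<Sum>i<n. B $$ (i, i))"
    using mats by simp
  also have "\<dots> = (\<Sum>i<n. es ! i)"
    using mats unfolding diag[symmetric] by (auto simp: diag_mat_def)
  finally have tr: "(\<Sum>i<n. a i i) = (\<Sum>i<n. es ! i)"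
    by (simp add: A_def)
  \<comment> \<open>Otherwise every eigenvalue lies strictly below the average, and summation puts
    the trace strictly below itself.\<close>
  have "\<exists>i<n. (\<Sum>i<n. Re (a i i)) \<le> real n * Re (es ! i)"
  proof (rule ccontr)
    assume "\<not> ?thesis"
    then have "(\<Sum>i<n. real n * Re (es ! i)) < (\<Sum>i<n. \<Sum>i<n. Re (a i i))"
      using assms by (intro sum_strict_mono) (auto simp: not_le)
    moreover have "(\<Sum>i<n. Re (a i i)) = (\<Sum>i<n. Re (es ! i))"
      using arg_cong[OF tr, of Re] by simp
    ultimately show False
      by (simp flip: sum_distrib_left)
  qed
  then obtain k where k: "k < n" "(\<Sum>i<n. Re (a i i)) \<le> real n * Re (es ! k)"
    by blast
  have "poly (char_poly A) (es ! k) = 0"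
    using k es by (simp add: poly_prod_list prod_list_zero_iff image_iff)
  then obtain v where v: "v \<in> carrier_vec n" "v \<noteq> 0\<^sub>v n" "A *\<^sub>v v = es ! k \<cdot>\<^sub>v v"
    using eigenvalue_root_char_poly[OF A] A unfolding eigenvalue_def eigenvector_def by auto
  show thesis
  proof
    show "\<exists>i<n. vec_index v i \<noteq> 0"
      using v(1,2) by (metis carrier_vecD eq_vecI index_zero_vec)
    show "(\<Sum>j<n. a i j * vec_index v j) = es ! k * vec_index v i" if "i < n" for i
      using arg_cong[OF v(3), of "\<lambda>x. vec_index x i"] v(1) that
      by (simp add: A_def scalar_prod_def atLeast0LessThan)
  qed (rule k)
qed

text \<open>Eigenvectors for distinct eigenvalues are independent, so there are at most
  \<open>card B\<close> of them. Linearity of \<open>T\<close> is asked only on \<open>V\<close>,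
  because a differential operator respects sums only of differentiable functions. \<open>J\<close>
  consists of scalars since it will be a set of eigenvalues.\<close>

lemma (in vector_space) finite_eigenvalues:
  assumes T: "\<And>(J :: 'a set) c f. finite J \<Longrightarrow> (\<And>j. j \<in> J \<Longrightarrow> f j \<in> V) \<Longrightarrow>
      T (\<Sum>j\<in>J. scale (c j) (f j)) = (\<Sum>j\<in>J. scale (c j) (T (f j)))"
    and "finite B" "V \<subseteq> span B"
  shows "finite {\<mu>. \<exists>v\<in>V. v \<noteq> 0 \<and> T v = scale \<mu> v}" (is "finite ?E")
proof -
  have "\<forall>\<mu>\<in>?E. \<exists>v. v \<in> V \<and> v \<noteq> 0 \<and> T v = scale \<mu> v"
    by blast
  then obtain v where v: "\<And>\<mu>. \<mu> \<in> ?E \<Longrightarrow> v \<mu> \<in> V \<and> v \<mu> \<noteq> 0 \<and> T (v \<mu>) = scale \<mu> (v \<mu>)"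
    unfolding bchoice_iff by blast
  have zero: "c \<mu> = 0" if "finite F" "F \<subseteq> ?E" "(\<Sum>\<mu>\<in>F. scale (c \<mu>) (v \<mu>)) = 0" "\<mu> \<in> F" for F c \<mu>
    using that
  proof (induction F arbitrary: c \<mu> rule: finite_induct)
    case (insert \<nu> F)
    let ?S = "\<Sum>\<mu>\<in>insert \<nu> F. scale (c \<mu>) (v \<mu>)"
    have "T ?S = (\<Sum>\<mu>\<in>insert \<nu> F. scale (c \<mu>) (T (v \<mu>)))"
      by (rule T) (use insert.hyps insert.prems(1) v in auto)
    also have "\<dots> = (\<Sum>\<mu>\<in>insert \<nu> F. scale (\<mu> * c \<mu>) (v \<mu>))"
    proof (rule sum.cong)
      show "scale (c \<mu>) (T (v \<mu>)) = scale (\<mu> * c \<mu>) (v \<mu>)" if "\<mu> \<in> insert \<nu> F" for \<mu>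
      proof -
        have "\<mu> \<in> ?E"
          using insert.prems(1) that by (rule subsetD)
        from v[OF this] show ?thesis by (simp add: mult.commute)
      qed
    qed simp
    \<comment> \<open>The instance of \<open>T\<close> for the empty set gives
      \<open>T 0 = 0\<close>.\<close>
    finally have "(\<Sum>\<mu>\<in>insert \<nu> F. scale (\<mu> * c \<mu>) (v \<mu>)) = 0"
      using insert.prems(2) T[of "{}"] by simp
    \<comment> \<open>Subtracting \<nu> times the relation from its image under \<open>T\<close>
      removes the term of \<nu>; the induction hypothesis then applies to the coefficients
      \<open>(\<mu> - \<nu>) * c \<mu>\<close>.\<close>
    then have "(\<Sum>\<mu>\<in>insert \<nu> F. scale (\<mu> * c \<mu>) (v \<mu>)) - scale \<nu> ?S = 0"
      using insert.prems(2) by simp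
    then have "(\<Sum>\<mu>\<in>F. scale ((\<mu> - \<nu>) * c \<mu>) (v \<mu>)) = 0"
      using insert.hyps
      by (simp add: scale_sum_right scale_right_distrib scale_left_diff_distrib left_diff_distrib
          sum_subtractf)
    then have "(\<mu> - \<nu>) * c \<mu> = 0" if "\<mu> \<in> F" for \<mu>
      using insert.IH[of "\<lambda>\<mu>. (\<mu> - \<nu>) * c \<mu>"] insert.prems(1) that by simp
    then have F: "c \<mu> = 0" if "\<mu> \<in> F" for \<mu>
      using insert.hyps that by auto
    then have "scale (c \<nu>) (v \<nu>) = 0"
      using insert.prems(2) insert.hyps by simp
    moreover have "v \<nu> \<noteq> 0"
      using v[OF subsetD[OF insert.prems(1) insertI1]] by simp
    ultimately have "c \<nu> = 0"
      by simp
    with F show ?case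
      using insert.prems(3) by blast
  qed simp
  have inj: "inj_on v ?E"
  proof (rule inj_onI)
    fix \<mu> \<nu> assume \<mu>: "\<mu> \<in> ?E" and \<nu>: "\<nu> \<in> ?E" and eq: "v \<mu> = v \<nu>"
    from v[OF \<mu>] v[OF \<nu>] have "scale \<mu> (v \<nu>) = scale \<nu> (v \<nu>)" "v \<nu> \<noteq> 0"
      unfolding eq by simp_all
    then show "\<mu> = \<nu>" by simp
  qed
  have "card F \<le> card B" if F: "F \<subseteq> ?E" "finite F" for F
  proof -
    have injF: "inj_on v F" using inj F(1) by (rule inj_on_subset)
    have "independent (v ` F)"
    proof (rule independent_if_scalars_zero)
      fix f x assume sum: "(\<Sum>x\<in>v ` F. scale (f x) x) = 0" and x: "x \<in> v ` F"
      have "(\<Sum>\<mu>\<in>F. scale (f (v \<mu>)) (v \<mu>)) = 0"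
        using sum unfolding sum.reindex[OF injF] comp_def .
      from zero[OF F(2,1) this] x show "f x = 0"
        by (elim imageE) simp
    qed (use F in simp)
    moreover have "v ` F \<subseteq> span B"
      using v[OF subsetD[OF F(1)]] subsetD[OF assms(3)] by (intro image_subsetI) simp
    ultimately have "card (v ` F) \<le> card B" using independent_span_bound assms(2) by blast
    then show ?thesis using injF by (simp add: card_image)
  qed
  then show ?thesis
    by (rule finite_if_finite_subsets_card_bdd[THEN conjunct1])
qed

section \<open>Linearity of the operators\<close>

text \<open>Separates the complex-linear part of the differential from the antilinear one; the
  Wirtinger derivatives of monomials are read off this way.\<close>

lemma wirtinger_eqs:
  assumes "(f has_derivative (\<lambda>v. \<alpha> * fst v + \<beta> * snd v + \<gamma> * cnj (fst v) + \<delta> * cnj (snd v))) (at p)"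
  shows "dz1 f p = \<alpha>" "dz2 f p = \<beta>" "dzbar1 f p = \<gamma>" "dzbar2 f p = \<delta>"
  unfolding dz1_def dz2_def dzbar1_def dzbar2_def frechet_derivative_at[OF assms, symmetric]
  by (simp_all add: algebra_simps)

lemma frechet_derivative_lincomb:
  fixes f :: "'i \<Rightarrow> complex \<times> complex \<Rightarrow> complex"
  assumes "\<And>j. j \<in> J \<Longrightarrow> f j differentiable (at p)"
  shows "frechet_derivative (\<lambda>q. \<Sum>j\<in>J. c j * f j q) (at p) =
    (\<lambda>v. \<Sum>j\<in>J. c j * frechet_derivative (f j) (at p) v)"
proof -
  have "((\<lambda>q. \<Sum>j\<in>J. c j * f j q) has_derivative
      (\<lambda>v. \<Sum>j\<in>J. c j * frechet_derivative (f j) (at p) v)) (at p)"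
    by (intro has_derivative_sum has_derivative_mult_right)
      (use assms in \<open>simp flip: frechet_derivative_works\<close>)
  then show ?thesis
    by (rule frechet_derivative_at[symmetric])
qed

lemma wirtinger_lincomb:
  fixes f :: "'i \<Rightarrow> complex \<times> complex \<Rightarrow> complex"
  assumes "\<And>j. j \<in> J \<Longrightarrow> f j differentiable (at p)"
  shows "dz1 (\<lambda>q. \<Sum>j\<in>J. c j * f j q) p = (\<Sum>j\<in>J. c j * dz1 (f j) p)"
    and "dz2 (\<lambda>q. \<Sum>j\<in>J. c j * f j q) p = (\<Sum>j\<in>J. c j * dz2 (f j) p)"
    and "dzbar1 (\<lambda>q. \<Sum>j\<in>J. c j * f j q) p = (\<Sum>j\<in>J. c j * dzbar1 (f j) p)"
    and "dzbar2 (\<lambda>q. \<Sum>j\<in>J. c j * f j q) p = (\<Sum>j\<in>J. c j * dzbar2 (f j) p)"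
  unfolding dz1_def dz2_def dzbar1_def dzbar2_def frechet_derivative_lincomb[of J f p, OF assms, simplified]
  by (simp_all add: sum_divide_distrib sum_distrib_left sum_subtractf sum.distrib algebra_simps
      diff_divide_distrib add_divide_distrib)

lemma Lt_op_lincomb:
  fixes f :: "'i \<Rightarrow> complex \<times> complex \<Rightarrow> complex"
  assumes "\<And>j. j \<in> J \<Longrightarrow> f j differentiable (at p)"
  shows "L_op (\<lambda>q. \<Sum>j\<in>J. c j * f j q) p = (\<Sum>j\<in>J. c j * L_op (f j) p)"
    and "Lbar_op (\<lambda>q. \<Sum>j\<in>J. c j * f j q) p = (\<Sum>j\<in>J. c j * Lbar_op (f j) p)"
    and "Lt_op t (\<lambda>q. \<Sum>j\<in>J. c j * f j q) p = (\<Sum>j\<in>J. c j * Lt_op t (f j) p)"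
    and "Lbart_op t (\<lambda>q. \<Sum>j\<in>J. c j * f j q) p = (\<Sum>j\<in>J. c j * Lbart_op t (f j) p)"
proof -
  show L: "L_op (\<lambda>q. \<Sum>j\<in>J. c j * f j q) p = (\<Sum>j\<in>J. c j * L_op (f j) p)"
    "Lbar_op (\<lambda>q. \<Sum>j\<in>J. c j * f j q) p = (\<Sum>j\<in>J. c j * Lbar_op (f j) p)"
    unfolding L_op_def Lbar_op_def case_prod_beta prod.collapse wirtinger_lincomb[of J f p, OF assms, simplified]
    by (simp_all add: sum_distrib_left sum_subtractf algebra_simps)
  show "Lt_op t (\<lambda>q. \<Sum>j\<in>J. c j * f j q) p = (\<Sum>j\<in>J. c j * Lt_op t (f j) p)"
    "Lbart_op t (\<lambda>q. \<Sum>j\<in>J. c j * f j q) p = (\<Sum>j\<in>J. c j * Lbart_op t (f j) p)"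
    unfolding Lt_op_def Lbart_op_def L
    by (simp_all add: sum_distrib_left sum.distrib algebra_simps)
qed

lemma Lt_op_lincomb2:
  fixes f g :: "complex \<times> complex \<Rightarrow> complex"
  assumes "f differentiable (at p)" "g differentiable (at p)"
  shows "Lt_op t (\<lambda>q. a * f q + b * g q) p = a * Lt_op t f p + b * Lt_op t g p"
  using Lt_op_lincomb(3)[of "{0, 1::nat}" "\<lambda>i. if i = 0 then f else g" p t "\<lambda>i. if i = 0 then a else b"] assms
  by simp

section \<open>Action on monomials and the upper bound\<close>

definition multidegrees :: "nat \<Rightarrow> (nat \<times> nat \<times> nat \<times> nat) set" where
  "multidegrees k = {(a, b, a', b'). a + b + a' + b' = k}"

fun zmonom :: "nat \<times> nat \<times> nat \<times> nat \<Rightarrow> complex \<times> complex \<Rightarrow> complex" where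
  "zmonom (a, b, a', b') p = fst p ^ a * snd p ^ b * cnj (fst p) ^ a' * cnj (snd p) ^ b'"

declare zmonom.simps [simp del]

lemma finite_multidegrees: "finite (multidegrees k)"
  by (rule finite_subset[of _ "{..k} \<times> {..k} \<times> {..k} \<times> {..k}"]) (auto simp: multidegrees_def)

lemma homogeneous_polys_iff:
  "f \<in> homogeneous_polys k \<longleftrightarrow> (\<exists>c. f = (\<lambda>p. \<Sum>i\<in>multidegrees k. c i * zmonom i p))"
proof
  assume "f \<in> homogeneous_polys k"
  then obtain c where c: "\<And>z1 z2. f (z1, z2) = (\<Sum>(a, b, a', b') \<in> multidegrees k.
      c a b a' b' * z1 ^ a * z2 ^ b * cnj z1 ^ a' * cnj z2 ^ b')"
    unfolding homogeneous_polys_def multidegrees_def by blast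
  show "\<exists>c. f = (\<lambda>p. \<Sum>i\<in>multidegrees k. c i * zmonom i p)"
    by (rule exI[of _ "\<lambda>(a, b, a', b'). c a b a' b'"])
      (auto simp: fun_eq_iff c case_prod_beta mult.assoc zmonom.simps intro!: sum.cong)
next
  assume "\<exists>c. f = (\<lambda>p. \<Sum>i\<in>multidegrees k. c i * zmonom i p)"
  then obtain c where c: "f = (\<lambda>p. \<Sum>i\<in>multidegrees k. c i * zmonom i p)" ..
  show "f \<in> homogeneous_polys k"
    unfolding homogeneous_polys_def multidegrees_def[symmetric] mem_Collect_eq
    by (rule exI[of _ "\<lambda>a b a' b'. c (a, b, a', b')"])
      (auto simp: c case_prod_beta mult.assoc zmonom.simps intro!: sum.cong)
qed

text \<open>Truncated exponents such as \<open>a - 1\<close> at \<open>a = 0\<close> are harmless,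
  since the factor \<open>of_nat a\<close> vanishes there.\<close>

lemma has_derivative_zmonom:
  "(zmonom (a, b, a', b') has_derivative (\<lambda>v.
      of_nat a * zmonom (a - 1, b, a', b') p * fst v + of_nat b * zmonom (a, b - 1, a', b') p * snd v +
      of_nat a' * zmonom (a, b, a' - 1, b') p * cnj (fst v) +
      of_nat b' * zmonom (a, b, a', b' - 1) p * cnj (snd v))) (at p)"
proof -
  have lin: "(fst has_derivative fst) (at p)" "(snd has_derivative snd) (at p)"
    "((\<lambda>q. cnj (fst q)) has_derivative (\<lambda>v. cnj (fst v))) (at p)"
    "((\<lambda>q. cnj (snd q)) has_derivative (\<lambda>v. cnj (snd v))) (at p)" for p :: "complex \<times> complex"
    by (intro bounded_linear_imp_has_derivative bounded_linear_fst bounded_linear_snd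
        bounded_linear_compose[OF bounded_linear_cnj])+
  show ?thesis
    unfolding zmonom.simps[abs_def]
    by (rule has_derivative_eq_rhs[OF has_derivative_mult[OF has_derivative_mult[OF has_derivative_mult[OF
          has_derivative_power[OF lin(1)] has_derivative_power[OF lin(2)]]
          has_derivative_power[OF lin(3)]] has_derivative_power[OF lin(4)]]])
      (simp add: fun_eq_iff algebra_simps)
qed

lemmas zmonom_wirtinger = wirtinger_eqs[OF has_derivative_zmonom]

lemma differentiable_zmonom: "zmonom i differentiable (at p)"
  unfolding differentiable_def by (cases i) (use has_derivative_zmonom in blast)

lemma differentiable_homogeneous_polys:
  assumes "f \<in> homogeneous_polys k"
  shows "f differentiable (at p)"
proof -
  obtain c where "f = (\<lambda>p. \<Sum>i\<in>multidegrees k. c i * zmonom i p)"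
    using assms unfolding homogeneous_polys_iff by blast
  then show ?thesis
    by (simp only:)
      (intro differentiable_sum finite_multidegrees ballI differentiable_mult differentiable_const differentiable_zmonom)
qed

text \<open>Each operator trades one factor for another of degree one, so the total degree is kept
  wherever the coefficient is nonzero.\<close>

lemma L_op_zmonom:
  "L_op (zmonom (a, b, a', b')) p =
    of_nat b * zmonom (a, b - 1, Suc a', b') p - of_nat a * zmonom (a - 1, b, a', Suc b') p"
  "Lbar_op (zmonom (a, b, a', b')) p =
    of_nat b' * zmonom (Suc a, b, a', b' - 1) p - of_nat a' * zmonom (a, Suc b, a' - 1, b') p"
  unfolding L_op_def Lbar_op_def case_prod_beta prod.collapse zmonom_wirtinger
  by (simp_all add: zmonom.simps mult_ac)

text \<open>The bound is on the coefficients of some representation, so that uniqueness of the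
  coefficients is never needed.\<close>

definition coeff_ball :: "nat \<Rightarrow> real \<Rightarrow> (complex \<times> complex \<Rightarrow> complex) set" where
  "coeff_ball k M = {f. \<exists>c. f = (\<lambda>p. \<Sum>i\<in>multidegrees k. c i * zmonom i p) \<and>
      (\<Sum>i\<in>multidegrees k. cmod (c i)) \<le> M}"

section \<open>Calculus of coefficient bounds\<close>

lemma coeff_ball_imp_homogeneous: "f \<in> coeff_ball k M \<Longrightarrow> f \<in> homogeneous_polys k"
  unfolding homogeneous_polys_iff coeff_ball_def by blast

lemma homogeneous_imp_coeff_ball:
  assumes "f \<in> homogeneous_polys k"
  obtains M where "0 \<le> M" "f \<in> coeff_ball k M"
proof -
  obtain c where "f = (\<lambda>p. \<Sum>i\<in>multidegrees k. c i * zmonom i p)"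
    using assms unfolding homogeneous_polys_iff by blast
  then have "f \<in> coeff_ball k (\<Sum>i\<in>multidegrees k. cmod (c i))"
    unfolding coeff_ball_def by blast
  then show thesis
    by (rule that[rotated]) (simp add: sum_nonneg)
qed

lemma coeff_ball_mono: "f \<in> coeff_ball k M \<Longrightarrow> M \<le> N \<Longrightarrow> f \<in> coeff_ball k N"
  unfolding coeff_ball_def by force

lemma coeff_ball_add:
  assumes "f \<in> coeff_ball k M" "g \<in> coeff_ball k N"
  shows "(\<lambda>p. f p + g p) \<in> coeff_ball k (M + N)"
proof -
  obtain c d where cd: "f = (\<lambda>p. \<Sum>i\<in>multidegrees k. c i * zmonom i p)"
    "g = (\<lambda>p. \<Sum>i\<in>multidegrees k. d i * zmonom i p)"
    "(\<Sum>i\<in>multidegrees k. cmod (c i)) \<le> M" "(\<Sum>i\<in>multidegrees k. cmod (d i)) \<le> N"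
    using assms unfolding coeff_ball_def by blast
  have "(\<Sum>i\<in>multidegrees k. cmod (c i + d i)) \<le> (\<Sum>i\<in>multidegrees k. cmod (c i) + cmod (d i))"
    by (intro sum_mono norm_triangle_ineq)
  with cd show ?thesis
    unfolding coeff_ball_def
    by (intro CollectI exI[of _ "\<lambda>i. c i + d i"]) (auto simp: sum.distrib algebra_simps)
qed

lemma coeff_ball_scale:
  assumes "f \<in> coeff_ball k M"
  shows "(\<lambda>p. a * f p) \<in> coeff_ball k (cmod a * M)"
proof -
  obtain c where c: "f = (\<lambda>p. \<Sum>i\<in>multidegrees k. c i * zmonom i p)"
    "(\<Sum>i\<in>multidegrees k. cmod (c i)) \<le> M"
    using assms unfolding coeff_ball_def by blast
  then show ?thesis
    unfolding coeff_ball_def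
    by (intro CollectI exI[of _ "\<lambda>i. a * c i"])
      (auto simp: sum_distrib_left[symmetric] norm_mult mult.assoc intro!: mult_left_mono)
qed

lemma coeff_ball_zero: "(\<lambda>p. 0) \<in> coeff_ball k 0"
  unfolding coeff_ball_def by (intro CollectI exI[of _ "\<lambda>i. 0"]) auto

lemma coeff_ball_sum:
  "(\<And>j. j \<in> J \<Longrightarrow> f j \<in> coeff_ball k (M j)) \<Longrightarrow> (\<lambda>p. \<Sum>j\<in>J. f j p) \<in> coeff_ball k (\<Sum>j\<in>J. M j)"
  by (induction J rule: infinite_finite_induct) (auto intro: coeff_ball_zero coeff_ball_add)

text \<open>The degree condition is waived for a zero coefficient because the truncated exponents in
  \<open>L_op_zmonom\<close> can leave degree \<open>k\<close>.\<close>

lemma coeff_ball_zmonom: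
  assumes "a \<noteq> 0 \<Longrightarrow> i \<in> multidegrees k"
  shows "(\<lambda>p. a * zmonom i p) \<in> coeff_ball k (cmod a)"
proof (cases "a = 0")
  case False
  then have "zmonom i \<in> coeff_ball k 1"
    using assms finite_multidegrees[of k] unfolding coeff_ball_def
    by (intro CollectI exI[of _ "\<lambda>j. of_bool (j = i)"])
      (auto simp: fun_eq_iff of_bool_def if_distrib[of "\<lambda>x. x * _"] if_distrib[of cmod] cong: if_cong)
  from coeff_ball_scale[OF this, of a] show ?thesis by simp
qed (use coeff_ball_zero in auto)

lemma cmod_zmonom_le: "p \<in> S3 \<Longrightarrow> cmod (zmonom i p) \<le> 1"
proof -
  assume "p \<in> S3"
  then have "cmod (fst p) \<le> 1" "cmod (snd p) \<le> 1"
    using norm_fst_le[of "fst p" "snd p"] norm_snd_le[of "snd p" "fst p"] by (auto simp: S3_def)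
  then show ?thesis
    by (cases i) (auto simp: zmonom.simps norm_mult norm_power intro!: mult_le_one power_le_one)
qed

lemma coeff_ball_bound:
  assumes "f \<in> coeff_ball k M" "p \<in> S3"
  shows "cmod (f p) \<le> M"
proof -
  obtain c where c: "f = (\<lambda>p. \<Sum>i\<in>multidegrees k. c i * zmonom i p)"
    "(\<Sum>i\<in>multidegrees k. cmod (c i)) \<le> M"
    using assms unfolding coeff_ball_def by blast
  have "cmod (f p) \<le> (\<Sum>i\<in>multidegrees k. cmod (c i))"
    unfolding c(1) by (rule sum_norm_le) (use cmod_zmonom_le[OF assms(2)] in \<open>auto simp: norm_mult mult_left_le\<close>)
  with c(2) show ?thesis by simp
qed

text \<open>The two coefficients are, up to sign, exponents of different factors of one monomial of
  degree \<open>k\<close>, so their moduli sum to at most \<open>k\<close>.\<close>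

lemma L_op_zmonom_coeff_ball:
  assumes "i \<in> multidegrees k"
  shows "L_op (zmonom i) \<in> coeff_ball k k" "Lbar_op (zmonom i) \<in> coeff_ball k k"
proof -
  obtain a b a' b' where i: "i = (a, b, a', b')" by (cases i)
  have k: "a + b + a' + b' = k" using assms by (simp add: i multidegrees_def)
  have "(\<lambda>p. of_nat b * zmonom (a, b - 1, Suc a', b') p + (- of_nat a) * zmonom (a - 1, b, a', Suc b') p)
      \<in> coeff_ball k (cmod (of_nat b) + cmod (- of_nat a))"
    by (intro coeff_ball_add coeff_ball_zmonom) (use k in \<open>auto simp: multidegrees_def\<close>)
  from coeff_ball_mono[OF this, of k] show "L_op (zmonom i) \<in> coeff_ball k k"
    using k by (simp add: i L_op_zmonom[abs_def])
  have "(\<lambda>p. of_nat b' * zmonom (Suc a, b, a', b' - 1) p + (- of_nat a') * zmonom (a, Suc b, a' - 1, b') p)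
      \<in> coeff_ball k (cmod (of_nat b') + cmod (- of_nat a'))"
    by (intro coeff_ball_add coeff_ball_zmonom) (use k in \<open>auto simp: multidegrees_def\<close>)
  from coeff_ball_mono[OF this, of k] show "Lbar_op (zmonom i) \<in> coeff_ball k k"
    using k by (simp add: i L_op_zmonom[abs_def])
qed

lemma L_op_coeff_ball:
  assumes "f \<in> coeff_ball k M"
  shows "L_op f \<in> coeff_ball k (k * M)" "Lbar_op f \<in> coeff_ball k (k * M)"
proof -
  obtain c where c: "f = (\<lambda>p. \<Sum>i\<in>multidegrees k. c i * zmonom i p)"
    "(\<Sum>i\<in>multidegrees k. cmod (c i)) \<le> M"
    using assms unfolding coeff_ball_def by blast
  have M: "(\<Sum>i\<in>multidegrees k. cmod (c i) * k) \<le> k * M"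
    using mult_left_mono[OF c(2), of k] by (simp add: sum_distrib_left mult.commute)
  have *: "(\<lambda>p. \<Sum>i\<in>multidegrees k. c i * g i p) \<in> coeff_ball k (k * M)"
    if "\<And>i. i \<in> multidegrees k \<Longrightarrow> g i \<in> coeff_ball k k" for g
    by (rule coeff_ball_mono[OF _ M]) (intro coeff_ball_sum coeff_ball_scale that)
  show "L_op f \<in> coeff_ball k (k * M)" "Lbar_op f \<in> coeff_ball k (k * M)"
    using *[of "\<lambda>i. L_op (zmonom i)", OF L_op_zmonom_coeff_ball(1)] *[of "\<lambda>i. Lbar_op (zmonom i)", OF L_op_zmonom_coeff_ball(2)]
    unfolding c(1) Lt_op_lincomb(1,2)[OF differentiable_zmonom, abs_def] by simp_all
qed

section \<open>Growth of coefficients under the perturbed operators\<close>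

definition box_const :: "complex \<Rightarrow> real" where
  "box_const t = (1 + (cmod t)\<^sup>2) / (1 - (cmod t)\<^sup>2)\<^sup>2"

lemma box_const_nonneg: "box_const t \<ge> 0"
  by (simp add: box_const_def)

lemma Lt_op_coeff_ball:
  assumes "f \<in> coeff_ball k M"
  shows "Lt_op t f \<in> coeff_ball k ((1 + cmod t) * k * M)"
    and "Lbart_op t f \<in> coeff_ball k ((1 + cmod t) * k * M)"
proof -
  note L = L_op_coeff_ball[OF assms]
  show "Lt_op t f \<in> coeff_ball k ((1 + cmod t) * k * M)"
    using coeff_ball_add[OF L(1) coeff_ball_scale[OF L(2), of "cnj t"]]
    by (simp add: Lt_op_def[abs_def] algebra_simps)
  show "Lbart_op t f \<in> coeff_ball k ((1 + cmod t) * k * M)"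
    using coeff_ball_add[OF L(2) coeff_ball_scale[OF L(1), of t]]
    by (simp add: Lbart_op_def[abs_def] algebra_simps)
qed

text \<open>Each of the two first-order factors costs \<open>(1 + cmod t) * k\<close>, whence the
  squares.\<close>

lemma box_op_coeff_ball:
  assumes "f \<in> coeff_ball k M"
  shows "box_op t f \<in> coeff_ball k (box_const t * (1 + cmod t)\<^sup>2 * (real k)\<^sup>2 * M)"
proof -
  note 1 = coeff_ball_scale[OF Lt_op_coeff_ball(2)[OF assms], of "complex_of_real (box_const t)" t]
  from coeff_ball_scale[OF Lt_op_coeff_ball(1)[OF this], of "-1" t]
  show ?thesis
    using box_const_nonneg[of t]
    unfolding box_op_def[abs_def] box_const_def[symmetric] by (simp add: power2_eq_square mult_ac)
qed

lemma box_op_homogeneous: "f \<in> homogeneous_polys k \<Longrightarrow> box_op t f \<in> homogeneous_polys k"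
  by (rule homogeneous_imp_coeff_ball) (auto intro: coeff_ball_imp_homogeneous box_op_coeff_ball)

lemma scaled_Lbart_homogeneous:
  "f \<in> homogeneous_polys k \<Longrightarrow> (\<lambda>q. c * Lbart_op t f q) \<in> homogeneous_polys k"
  by (rule homogeneous_imp_coeff_ball)
    (auto intro: coeff_ball_imp_homogeneous coeff_ball_scale Lt_op_coeff_ball(2))

lemma box_op_lincomb:
  assumes "\<And>j. j \<in> J \<Longrightarrow> f j \<in> homogeneous_polys k"
  shows "box_op t (\<lambda>q. \<Sum>j\<in>J. c j * f j q) = (\<lambda>p. \<Sum>j\<in>J. c j * box_op t (f j) p)"
proof
  fix p
  define C where "C = complex_of_real ((1 + (cmod t)\<^sup>2) / (1 - (cmod t)\<^sup>2)\<^sup>2)"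
  have "(\<lambda>q. C * Lbart_op t (\<lambda>q. \<Sum>j\<in>J. c j * f j q) q) = (\<lambda>q. \<Sum>j\<in>J. c j * (C * Lbart_op t (f j) q))"
    by (subst Lt_op_lincomb(4))
      (auto simp: sum_distrib_left mult_ac intro: differentiable_homogeneous_polys assms)
  moreover have "Lt_op t (\<lambda>q. \<Sum>j\<in>J. c j * (C * Lbart_op t (f j) q)) p =
      (\<Sum>j\<in>J. c j * Lt_op t (\<lambda>q. C * Lbart_op t (f j) q) p)"
    by (rule Lt_op_lincomb(3)) (rule differentiable_homogeneous_polys[OF scaled_Lbart_homogeneous[OF assms]])
  ultimately show "box_op t (\<lambda>q. \<Sum>j\<in>J. c j * f j q) p = (\<Sum>j\<in>J. c j * box_op t (f j) p)"
    unfolding box_op_def C_def[symmetric] by (simp add: sum_negf)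
qed

section \<open>From the sphere to the whole space\<close>

lemma homogeneous_zero: "(\<lambda>p. 0) \<in> homogeneous_polys k"
  using coeff_ball_zero by (rule coeff_ball_imp_homogeneous)

lemma homogeneous_scale: "f \<in> homogeneous_polys k \<Longrightarrow> (\<lambda>p. a * f p) \<in> homogeneous_polys k"
  by (rule homogeneous_imp_coeff_ball) (auto intro: coeff_ball_imp_homogeneous coeff_ball_scale)

lemma homogeneous_eqI:
  assumes f: "f \<in> homogeneous_polys k" and g: "g \<in> homogeneous_polys k"
    and eq: "\<And>p. p \<in> S3 \<Longrightarrow> f p = g p"
  shows "f = g"
proof
  fix p
  obtain r u where p: "p = r *\<^sub>R u" and u: "u \<in> S3"
  proof (cases "p = 0")
    case True
    \<comment> \<open>At the origin any unit vector serves, with \<open>r = 0\<close>; in degree 0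
      the scaling law still holds since \<open>0 ^ 0 = 1\<close>.\<close>
    then show thesis
      by (intro that[of 0 "(1, 0)"]) (auto simp: S3_def zero_prod_def dist_Pair_Pair)
  next
    case False
    then show thesis
      by (intro that[of "norm p" "p /\<^sub>R norm p"]) (auto simp: S3_def)
  qed
  show "f p = g p"
    unfolding p homogeneous_polys_scaleR[OF f] homogeneous_polys_scaleR[OF g] eq[OF u] ..
qed

text \<open>Both sides of the eigenvalue equation are homogeneous of degree \<open>k\<close>, so an
  identity on the sphere extends to the whole space. This replaces \<open>box_S3\<close> by
  \<open>box_op\<close>.\<close>

lemma box_eigenvalues_iff:
  "\<mu> \<in> box_eigenvalues t k \<longleftrightarrow>
    (\<exists>f\<in>harmonic_polys k. f \<noteq> (\<lambda>p. 0) \<and> box_op t f = (\<lambda>p. \<mu> * f p))"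
proof -
  have restrict_eq: "restrict f A = restrict g A \<longleftrightarrow> (\<forall>p\<in>A. f p = g p)" for f g :: "complex \<times> complex \<Rightarrow> complex" and A
    by (auto simp: fun_eq_iff restrict_def)
  have "restrict f S3 \<noteq> restrict (\<lambda>_. 0) S3 \<and> box_S3 t (restrict f S3) = restrict (\<lambda>p. \<mu> * restrict f S3 p) S3 \<longleftrightarrow>
      f \<noteq> (\<lambda>p. 0) \<and> box_op t f = (\<lambda>p. \<mu> * f p)" if "f \<in> harmonic_polys k" for f
  proof -
    have f: "f \<in> homogeneous_polys k"
      using that by (simp add: harmonic_polys_def)
    have "restrict f S3 = restrict (\<lambda>_. 0) S3 \<longleftrightarrow> f = (\<lambda>p. 0)"
      unfolding restrict_eq using homogeneous_eqI[OF f homogeneous_zero] by auto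
    moreover have "box_S3 t (restrict f S3) = restrict (\<lambda>p. \<mu> * restrict f S3 p) S3 \<longleftrightarrow> box_op t f = (\<lambda>p. \<mu> * f p)"
      unfolding box_S3_restrict[OF f] restrict_eq
      using homogeneous_eqI[OF box_op_homogeneous[OF f] homogeneous_scale[OF f]] by auto
    ultimately show ?thesis by blast
  qed
  then show ?thesis
    unfolding box_eigenvalues_def spherical_harmonics_def by auto
qed

section \<open>Finiteness and size of the eigenvalues\<close>

lemma sum_fun_apply: "(\<Sum>j\<in>J. f j) p = (\<Sum>j\<in>J. f j p)"
  for f :: "'i \<Rightarrow> 'a \<Rightarrow> 'b::comm_monoid_add"
  by (induction J rule: infinite_finite_induct) auto

text \<open>Gives \<open>Max\<close> in \<open>lambda_max\<close> its meaning. The argument runs on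
  all homogeneous polynomials, for which the monomials are a finite spanning set.\<close>

lemma finite_box_eigenvalues: "finite (box_eigenvalues t k)"
proof -
  interpret F: vector_space "\<lambda>(c::complex) (f::complex \<times> complex \<Rightarrow> complex) p. c * f p"
    by unfold_locales (auto simp: fun_eq_iff algebra_simps)
  have "finite {\<mu>. \<exists>f\<in>homogeneous_polys k. f \<noteq> 0 \<and> box_op t f = (\<lambda>p. \<mu> * f p)}"
  proof (rule F.finite_eigenvalues)
    show "box_op t (\<Sum>j\<in>J. (\<lambda>p. c j * f j p)) = (\<Sum>j\<in>J. (\<lambda>p. c j * box_op t (f j) p))"
      if "\<And>j. j \<in> J \<Longrightarrow> f j \<in> homogeneous_polys k" for J :: "complex set" and c f
    proof -
      have eq: "(\<Sum>j\<in>J. (\<lambda>p. c j * g j p)) = (\<lambda>p. \<Sum>j\<in>J. c j * g j p)" for g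
        by (simp add: fun_eq_iff sum_fun_apply)
      show ?thesis
        unfolding eq by (rule box_op_lincomb) (rule that)
    qed
    show "finite (zmonom ` multidegrees k)"
      by (intro finite_imageI finite_multidegrees)
    show "homogeneous_polys k \<subseteq> F.span (zmonom ` multidegrees k)"
    proof
      fix f assume "f \<in> homogeneous_polys k"
      then obtain c where "f = (\<Sum>i\<in>multidegrees k. (\<lambda>p. c i * zmonom i p))"
        unfolding homogeneous_polys_iff by (auto simp: fun_eq_iff sum_fun_apply)
      then show "f \<in> F.span (zmonom ` multidegrees k)"
        by (simp only:) (intro F.span_sum F.span_scale F.span_base imageI)
    qed
  qed
  then show ?thesis
    by (rule rev_finite_subset) (auto simp: box_eigenvalues_iff harmonic_polys_def zero_fun_def)
qed

text \<open>Each iteration multiplies the eigenfunction by \<mu> but its coefficient bound only by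
  \<open>?K\<close>. The initial bound \<open>M\<close> is a fixed factor, so large \<open>n\<close>
  excludes \<open>?K < cmod \<mu>\<close>.\<close>

lemma box_eigenvalue_le:
  assumes "\<mu> \<in> box_eigenvalues t k"
  shows "cmod \<mu> \<le> box_const t * (1 + cmod t)\<^sup>2 * (real k)\<^sup>2" (is "_ \<le> ?K")
proof (rule ccontr)
  assume less: "\<not> ?thesis"
  obtain f where f: "f \<in> homogeneous_polys k" and "f \<noteq> (\<lambda>p. 0)" and box: "box_op t f = (\<lambda>p. \<mu> * f p)"
    using assms unfolding box_eigenvalues_iff harmonic_polys_def by blast
  then obtain p where p: "p \<in> S3" "f p \<noteq> 0"
    using homogeneous_eqI[OF f homogeneous_zero] by blast
  obtain M where M: "0 \<le> M" "f \<in> coeff_ball k M"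
    using homogeneous_imp_coeff_ball[OF f] .
  have "(\<lambda>p. \<mu> ^ n * f p) \<in> coeff_ball k (?K ^ n * M)" for n
  proof (induction n)
    case (Suc n)
    have "box_op t (\<lambda>p. \<mu> ^ n * f p) = (\<lambda>p. \<mu> ^ Suc n * f p)"
      using box_op_lincomb[of "{0::nat}" "\<lambda>_. f" k t "\<lambda>_. \<mu> ^ n"] f by (simp add: box mult_ac)
    with box_op_coeff_ball[OF Suc, of t] show ?case
      by (simp add: mult_ac)
  qed (use M in simp)
  from coeff_ball_bound[OF this p(1)] have le: "cmod \<mu> ^ n * cmod (f p) \<le> ?K ^ n * M" for n
    by (simp add: norm_mult norm_power)
  have K: "0 \<le> ?K"
    using box_const_nonneg by simp
  with less have \<mu>: "0 < cmod \<mu>" by linarith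
  have "?K / cmod \<mu> < 1"
    using less \<mu> by simp
  \<comment> \<open>Only \<open>0 \<le> M\<close> is at hand; \<open>M + 1\<close> gives a positive
    denominator.\<close>
  then obtain n where n: "(?K / cmod \<mu>) ^ n < cmod (f p) / (M + 1)"
    using real_arch_pow_inv[of "cmod (f p) / (M + 1)" "?K / cmod \<mu>"] p(2) M(1) by auto
  have "cmod (f p) \<le> (?K / cmod \<mu>) ^ n * M"
    using le[of n] \<mu> by (simp add: power_divide field_simps)
  also have "\<dots> \<le> (?K / cmod \<mu>) ^ n * (M + 1)"
    using K by (intro mult_left_mono zero_le_power divide_nonneg_nonneg) auto
  also have "\<dots> < cmod (f p)"
    using n M(1) by (simp add: field_simps)
  finally show False by simp
qed

section \<open>Large eigenvalues\<close>

text \<open>In the variables \<open>x = cnj z1\<close>, \<open>y = z2\<close> the operators act on polynomials as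
  \<open>L = x \<partial>/\<partial>y\<close> and \<open>Lbar = - y \<partial>/\<partial>x\<close>; the monomials below span an irreducible copy of the
  \<open>(k + 1)\<close>-dimensional representation of \<open>sl(2)\<close>.\<close>

definition vmonom :: "nat \<Rightarrow> nat \<Rightarrow> complex \<times> complex \<Rightarrow> complex" where
  "vmonom k j = zmonom (0, j, k - j, 0)"

lemma differentiable_vmonom: "vmonom k j differentiable (at p)"
  unfolding vmonom_def by (rule differentiable_zmonom)

text \<open>The index leaves the range only for \<open>j - 1\<close> at \<open>j = 0\<close> and
  \<open>Suc j\<close> at \<open>j = k\<close>, and there the coefficient is zero.\<close>

lemma L_op_vmonom:
  assumes "j \<le> k"
  shows "L_op (vmonom k j) p = of_nat j * vmonom k (j - 1) p"
    and "Lbar_op (vmonom k j) p = - (of_nat (k - j) * vmonom k (Suc j) p)"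
  using assms by (cases j; simp add: vmonom_def L_op_zmonom Suc_diff_Suc)+

lemma Lt_op_vmonom:
  assumes "j \<le> k"
  shows "Lt_op t (vmonom k j) p =
      of_nat j * vmonom k (j - 1) p - cnj t * of_nat (k - j) * vmonom k (Suc j) p"
    and "Lbart_op t (vmonom k j) p =
      t * of_nat j * vmonom k (j - 1) p - of_nat (k - j) * vmonom k (Suc j) p"
  using assms by (simp_all add: Lt_op_def Lbart_op_def L_op_vmonom)

text \<open>Entries whose index leaves the range \<open>0..k\<close> carry a vanishing coefficient; in particular the
  truncated \<open>j - 2\<close> only matters for \<open>j \<ge> 2\<close>.\<close>

definition box_matrix :: "complex \<Rightarrow> nat \<Rightarrow> nat \<Rightarrow> nat \<Rightarrow> complex" where
  "box_matrix t k i j = of_real (box_const t) *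
    ((if i = j then of_nat (k - j) * of_nat (Suc j) + t * cnj t * (of_nat j * of_nat (Suc k - j)) else 0)
     - (if i = Suc (Suc j) then cnj t * (of_nat (k - j) * of_nat (k - Suc j)) else 0)
     - (if i = j - 2 then t * (of_nat j * of_nat (j - 1)) else 0))"

text \<open>Both first-order operators shift the index by one in either direction, so the composite
  shifts it by -2, 0 or 2. The shift 0 arises in two ways, hence the two diagonal terms.\<close>

lemma box_op_vmonom:
  assumes "j \<le> k"
  shows "box_op t (vmonom k j) p = (\<Sum>i<Suc k. box_matrix t k i j * vmonom k i p)"
proof -
  define C where "C = complex_of_real (box_const t)"
  have 1: "of_nat j * Lt_op t (vmonom k (j - 1)) p =
      of_nat j * (of_nat (j - 1) * vmonom k (j - 2) p - cnj t * of_nat (Suc k - j) * vmonom k j p)"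
    using assms by (cases j) (simp_all add: Lt_op_vmonom numeral_2_eq_2)
  have 2: "of_nat (k - j) * Lt_op t (vmonom k (Suc j)) p =
      of_nat (k - j) * (of_nat (Suc j) * vmonom k j p - cnj t * of_nat (k - Suc j) * vmonom k (Suc (Suc j)) p)"
    using assms by (cases "j = k") (simp_all add: Lt_op_vmonom)
  have "Lbart_op t (vmonom k j) = (\<lambda>q. t * of_nat j * vmonom k (j - 1) q - of_nat (k - j) * vmonom k (Suc j) q)"
    using assms by (auto simp: Lt_op_vmonom)
  then have "(\<lambda>q. C * Lbart_op t (vmonom k j) q) =
      (\<lambda>q. (C * t * of_nat j) * vmonom k (j - 1) q + (- (C * of_nat (k - j))) * vmonom k (Suc j) q)"
    by (auto simp: algebra_simps)
  then have "box_op t (vmonom k j) p =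
      - ((C * t * of_nat j) * Lt_op t (vmonom k (j - 1)) p + (- (C * of_nat (k - j))) * Lt_op t (vmonom k (Suc j)) p)"
    unfolding box_op_def box_const_def[symmetric] C_def[symmetric]
    by (simp only: Lt_op_lincomb2[OF differentiable_vmonom differentiable_vmonom])
  also have "\<dots> = C * (of_nat (k - j) * Lt_op t (vmonom k (Suc j)) p) - C * t * (of_nat j * Lt_op t (vmonom k (j - 1)) p)"
    by (simp add: mult.assoc)
  also have "\<dots> = C *
      ((of_nat (k - j) * of_nat (Suc j) + t * cnj t * (of_nat j * of_nat (Suc k - j))) * vmonom k j p
       - cnj t * (of_nat (k - j) * of_nat (k - Suc j)) * vmonom k (Suc (Suc j)) p
       - t * (of_nat j * of_nat (j - 1)) * vmonom k (j - 2) p)"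
    unfolding 1 2 by (simp only: algebra_simps)
  also have "\<dots> = (\<Sum>i<Suc k. box_matrix t k i j * vmonom k i p)"
  proof -
    have delta: "(\<Sum>i<Suc k. (if i = m then x else 0) * vmonom k i p) = x * vmonom k m p"
      if "m \<le> k \<or> x = 0" for m x
      using that by (auto simp: if_distrib[of "\<lambda>y. y * _"] cong: if_cong)
    have "(\<Sum>i<Suc k. box_matrix t k i j * vmonom k i p) = C *
      ((\<Sum>i<Suc k. (if i = j then of_nat (k - j) * of_nat (Suc j) + t * cnj t * (of_nat j * of_nat (Suc k - j)) else 0) * vmonom k i p)
       - (\<Sum>i<Suc k. (if i = Suc (Suc j) then cnj t * (of_nat (k - j) * of_nat (k - Suc j)) else 0) * vmonom k i p)
       - (\<Sum>i<Suc k. (if i = j - 2 then t * (of_nat j * of_nat (j - 1)) else 0) * vmonom k i p))"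
      unfolding box_matrix_def C_def[symmetric]
      by (simp only: sum_distrib_left sum_subtractf left_diff_distrib right_diff_distrib mult.assoc)
    moreover have "j \<le> k \<or> x = 0" "Suc (Suc j) \<le> k \<or> cnj t * (of_nat (k - j) * of_nat (k - Suc j)) = 0" "j - 2 \<le> k \<or> x = 0" for x :: complex
      using assms by auto
    ultimately show ?thesis
      by (simp only: delta)
  qed
  finally show ?thesis .
qed

text \<open>Neither z1 nor the conjugate of z2 occurs, so both mixed derivatives in the Laplacian
  vanish.\<close>

lemma vmonom_lincomb_harmonic: "(\<lambda>p. \<Sum>j<Suc k. w j * vmonom k j p) \<in> harmonic_polys k"
proof -
  have "(\<lambda>p. \<Sum>j<Suc k. w j * vmonom k j p) \<in> coeff_ball k (\<Sum>j<Suc k. cmod (w j))"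
    unfolding vmonom_def by (intro coeff_ball_sum coeff_ball_zmonom) (auto simp: multidegrees_def)
  then have "(\<lambda>p. \<Sum>j<Suc k. w j * vmonom k j p) \<in> homogeneous_polys k"
    by (rule coeff_ball_imp_homogeneous)
  moreover have "complex_laplacian (\<lambda>p. \<Sum>j<Suc k. w j * vmonom k j p) p = 0" for p
  proof -
    have 1: "dzbar1 (\<lambda>p. \<Sum>j<Suc k. w j * vmonom k j p) =
        (\<lambda>p. \<Sum>j<Suc k. (w j * of_nat (k - j)) * zmonom (0, j, k - j - 1, 0) p)"
      unfolding vmonom_def wirtinger_lincomb(3)[OF differentiable_zmonom, abs_def] zmonom_wirtinger
      by (simp only: mult.assoc)
    have 2: "dzbar2 (\<lambda>p. \<Sum>j<Suc k. w j * vmonom k j p) = (\<lambda>p. 0)"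
      unfolding vmonom_def wirtinger_lincomb(4)[OF differentiable_zmonom, abs_def] zmonom_wirtinger
      by simp
    have "dz2 (\<lambda>p. 0) p = 0"
      using wirtinger_lincomb(2)[of "{}"] by simp
    then show ?thesis
      unfolding complex_laplacian_def 1 2 wirtinger_lincomb(1)[OF differentiable_zmonom] zmonom_wirtinger
      by simp
  qed
  ultimately show ?thesis
    by (simp add: harmonic_polys_def)
qed

section \<open>The trace estimate and a large eigenvalue\<close>

text \<open>\<open>x\<close> is independent of \<open>n\<close> so that the induction leaves it
  fixed. For \<open>x = k\<close> and \<open>n = k + 1\<close> the right side is k (k + 1) (k +
  2).\<close>

lemma sum_diagonal:
  "6 * (\<Sum>i<n. (x - real i) * (real i + 1)) =
    6 * x * n + 3 * (x - 1) * n * (real n - 1) - real n * (real n - 1) * (2 * real n - 1)"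
  by (induction n) (auto simp: algebra_simps)

lemma box_const_ge_1:
  assumes "cmod t < 1"
  shows "box_const t \<ge> 1"
proof -
  have t: "(cmod t)\<^sup>2 < 1"
    using assms by (simp add: power_less_one_iff)
  then have "(1 - (cmod t)\<^sup>2)\<^sup>2 \<le> 1"
    by (intro power_le_one) auto
  also have "\<dots> \<le> 1 + (cmod t)\<^sup>2"
    by simp
  finally show ?thesis
    unfolding box_const_def using t by (subst le_divide_eq_1_pos) auto
qed

text \<open>The diagonal sum has real part at least k (k + 1) (k + 2) / 6 and there are k + 1
  entries, so the average is at least k (k + 2) / 6.\<close>

lemma ex_large_box_eigenvalue:
  assumes t: "cmod t < 1"
  shows "\<exists>\<mu>\<in>box_eigenvalues t k. (real k)\<^sup>2 / 6 \<le> Re \<mu>"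
proof -
  obtain \<mu> w where w: "\<exists>i<Suc k. w i \<noteq> 0"
    and ev: "\<And>i. i < Suc k \<Longrightarrow> (\<Sum>j<Suc k. box_matrix t k i j * w j) = \<mu> * w i"
    and tr: "(\<Sum>i<Suc k. Re (box_matrix t k i i)) \<le> real (Suc k) * Re \<mu>"
    by (rule eigenvalue_Re_ge_average_diagonal[OF zero_less_Suc, of k "box_matrix t k"]) blast
  define f where "f = (\<lambda>p. \<Sum>j<Suc k. w j * vmonom k j p)"
  have f: "f \<in> harmonic_polys k"
    unfolding f_def by (rule vmonom_lincomb_harmonic)
  have "box_op t f = (\<lambda>p. \<Sum>j<Suc k. w j * box_op t (vmonom k j) p)"
    unfolding f_def vmonom_def
    by (rule box_op_lincomb[where k = k], rule coeff_ball_imp_homogeneous[where M = 1])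
      (use coeff_ball_zmonom[of 1] in \<open>auto simp: multidegrees_def\<close>)
  also have "\<dots> = (\<lambda>p. \<Sum>j<Suc k. \<Sum>i<Suc k. w j * (box_matrix t k i j * vmonom k i p))"
    by (intro ext sum.cong refl) (simp add: box_op_vmonom sum_distrib_left del: sum.lessThan_Suc)
  \<comment> \<open>Column \<open>j\<close> of the matrix is the image of \<open>vmonom k j\<close>;
    exchanging the sums exposes the eigenvector equation for \<open>w\<close>.\<close>
  also have "\<dots> = (\<lambda>p. \<Sum>i<Suc k. (\<Sum>j<Suc k. box_matrix t k i j * w j) * vmonom k i p)"
    by (subst sum.swap) (simp only: sum_distrib_left mult_ac)
  also have "\<dots> = (\<lambda>p. \<mu> * f p)"
    by (intro ext) (simp add: ev f_def sum_distrib_left mult.assoc del: sum.lessThan_Suc)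
  finally have box: "box_op t f = (\<lambda>p. \<mu> * f p)" .
  have "f \<noteq> (\<lambda>p. 0)"
  proof
    assume "f = (\<lambda>p. 0)"
    \<comment> \<open>At z1 = 1, z2 = y the function is the one-variable polynomial with
      coefficients \<open>w\<close>, which yields the independence of the
      \<open>vmonom k j\<close>.\<close>
    then have "f (1, y) = 0" for y
      by simp
    then have "\<forall>y. (\<Sum>j\<le>k. w j * y ^ j) = 0"
      by (simp add: f_def vmonom_def zmonom.simps lessThan_Suc_atMost del: sum.lessThan_Suc)
    then have "\<forall>j\<le>k. w j = 0"
      using polyfun_eq_0[where c = w and n = k] by blast
    with w show False by auto
  qed
  with f box have \<mu>: "\<mu> \<in> box_eigenvalues t k"
    unfolding box_eigenvalues_iff by blast
  have "real k * (real k + 1) * (real k + 2) / 6 = (\<Sum>i<Suc k. (real k - real i) * (real i + 1))"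
    using sum_diagonal[of "real k" "Suc k"] by (simp add: algebra_simps del: sum.lessThan_Suc)
  also have "\<dots> \<le> (\<Sum>i<Suc k. Re (box_matrix t k i i))"
  proof (rule sum_mono)
    fix i assume "i \<in> {..<Suc k}"
    then have i: "i \<le> k" by simp
    define d where "d = (real k - real i) * (real i + 1)"
    have tt: "t * cnj t = (complex_of_real (cmod t))\<^sup>2"
      by (simp add: complex_norm_square flip: of_real_power)
    have "box_matrix t k i i = complex_of_real (box_const t * (d + (cmod t)\<^sup>2 * (real i * real (Suc k - i))))"
      using i unfolding box_matrix_def d_def tt by (auto simp: of_nat_diff add.commute)
    then have "Re (box_matrix t k i i) = box_const t * (d + (cmod t)\<^sup>2 * (real i * real (Suc k - i)))"
      by (simp only: Re_complex_of_real)
    \<comment> \<open>The term with \<open>(cmod t)\<^sup>2\<close> is nonnegative and is dropped,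
      and \<open>box_const t\<close> is at least 1.\<close>
    also have "\<dots> \<ge> 1 * d"
      using box_const_ge_1[OF t] i by (intro mult_mono) (auto simp: d_def)
    finally show "(real k - real i) * (real i + 1) \<le> Re (box_matrix t k i i)"
      by (simp add: d_def)
  qed
  also have "\<dots> \<le> real (Suc k) * Re \<mu>"
    by (rule tr)
  finally have "(real k + 1) * (real k * (real k + 2) / 6) \<le> (real k + 1) * Re \<mu>"
    by (simp add: mult_ac add_ac)
  then have "real k * (real k + 2) / 6 \<le> Re \<mu>"
    by (subst (asm) mult_le_cancel_left_pos) auto
  moreover have "(real k)\<^sup>2 / 6 \<le> real k * (real k + 2) / 6"
    by (simp add: power2_eq_square algebra_simps)
  ultimately show ?thesis
    using \<mu> by (intro bexI[of _ \<mu>]) auto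
qed

theorem theorem4p4:
  fixes t :: complex
  assumes "cmod t < 1"
  shows "\<exists>c::real. c > 0 \<and>
           (\<forall>\<^sub>F k in sequentially.
              1 / c * (real k)\<^sup>2 \<le> lambda_max t k \<and> lambda_max t k \<le> c * (real k)\<^sup>2)"
proof -
  define K where "K = box_const t * (1 + cmod t)\<^sup>2"
  have "1 * 1 \<le> K"
    unfolding K_def using box_const_ge_1[OF assms] by (intro mult_mono) auto
  then have K: "1 \<le> K" by simp
  \<comment> \<open>One constant \<open>c = 6 * K\<close> serves both sides, for every
    \<open>k\<close>: the lower bound needs \<open>1 / c \<le> 1 / 6\<close>, the upper one
    \<open>K \<le> c\<close>, and both follow from \<open>1 \<le> K\<close>.\<close>
  have "1 / (6 * K) * (real k)\<^sup>2 \<le> lambda_max t k \<and> lambda_max t k \<le> 6 * K * (real k)\<^sup>2" for k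
  proof -
    let ?E = "Re ` box_eigenvalues t k"
    obtain \<mu> where \<mu>: "\<mu> \<in> box_eigenvalues t k" "(real k)\<^sup>2 / 6 \<le> Re \<mu>"
      using ex_large_box_eigenvalue[OF assms] by blast
    have fin: "finite ?E" by (intro finite_imageI finite_box_eigenvalues)
    have "1 / (6 * K) * (real k)\<^sup>2 \<le> 1 / 6 * (real k)\<^sup>2"
      using K by (intro mult_right_mono) (auto simp: field_simps)
    also have "\<dots> \<le> Re \<mu>"
      using \<mu>(2) by simp
    also have "\<dots> \<le> Max ?E"
      using fin \<mu>(1) by (intro Max_ge imageI)
    finally have lower: "1 / (6 * K) * (real k)\<^sup>2 \<le> lambda_max t k"
      by (simp add: lambda_max_def)
    have "Re \<nu> \<le> 6 * K * (real k)\<^sup>2" if "\<nu> \<in> box_eigenvalues t k" for \<nu>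
    proof -
      have "Re \<nu> \<le> K * (real k)\<^sup>2"
        using box_eigenvalue_le[OF that] complex_Re_le_cmod[of \<nu>] by (simp add: K_def)
      also have "\<dots> \<le> 6 * K * (real k)\<^sup>2"
        using K by (intro mult_right_mono) auto
      finally show ?thesis .
    qed
    \<comment> \<open>The eigenvalue \<mu> also shows that the set under \<open>Max\<close> is
      nonempty.\<close>
    then have "lambda_max t k \<le> 6 * K * (real k)\<^sup>2"
      unfolding lambda_max_def using fin \<mu>(1) by (subst Max_le_iff) auto
    with lower show ?thesis ..
  qed
  with K show ?thesis
    by (intro exI[of _ "6 * K"]) auto
qed

end
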